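(* Let $a=(a_n)_{n\ge1}\in\ell^\infty$ be a bounded sequence of real numbers. For every $N\ge1$, every $f\in L^1(\Omega,\mathbb P)$, and every $\lambda>0$, $$\mathbb P\bigl(|T_N(a;f)|>\lambda\bigr)\le\frac{16\,\|a\|_{\ell^\infty}\|f\|_1}{\lambda},$$ where $$T_N(a;f):=\sum_{n=1}^N a_n\,df_n,\qquad df_n:=\mathbb E_n[f]-\mathbb E_{n-1}[f].$$
   Context: $(\Omega,\mathcal F,\mathbb P)$ is a complete probability space with a discrete filtration $(\mathcal F_n)_{n\ge1}$. $\mathbb E_n:=\mathbb E[\,\cdot\mid\mathcal F_n]$ for $n\ge1$, and $\mathbb E_0\equiv0$ (the zero operator). Functions are real-valued, and $\|\cdot\|_1$ is the $L^1(\Omega,\mathbb P)$ norm. *)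

theory Defs
  imports "HOL-Probability.Probability" "HOL-Probability.Stopping_Time"
begin

text \<open>The filtration is indexed from 1; the value of \<open>F\<close> at 0 is never used, since
  the operator of index 0 is the zero operator and not a conditional expectation.\<close>

definition cond_exp_at ::
    "'a measure \<Rightarrow> (nat \<Rightarrow> 'a measure) \<Rightarrow> nat \<Rightarrow> ('a \<Rightarrow> real) \<Rightarrow> 'a \<Rightarrow> real" where
  "cond_exp_at M F n f = (if n = 0 then (\<lambda>_. 0) else real_cond_exp M (F n) f)"

definition mart_diff ::
    "'a measure \<Rightarrow> (nat \<Rightarrow> 'a measure) \<Rightarrow> ('a \<Rightarrow> real) \<Rightarrow> nat \<Rightarrow> 'a \<Rightarrow> real" where
  "mart_diff M F f n x = cond_exp_at M F n f x - cond_exp_at M F (n - 1) f x"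

definition mart_transform ::
    "'a measure \<Rightarrow> (nat \<Rightarrow> 'a measure) \<Rightarrow> nat \<Rightarrow> (nat \<Rightarrow> real) \<Rightarrow> ('a \<Rightarrow> real) \<Rightarrow> 'a \<Rightarrow> real" where
  "mart_transform M F N a f x = (\<Sum>n = 1..N. a n * mart_diff M F f n x)"

text \<open>Only the entries of index at least 1 belong to the sequence. The supremum is the
  conditionally complete one on the reals, so it is meaningful only for bounded sequences.\<close>

definition linf_norm :: "(nat \<Rightarrow> real) \<Rightarrow> real" where
  "linf_norm a = (SUP n\<in>{1..}. \<bar>a n\<bar>)"

end

theory Submission
  imports Defs
begin

text \<open>Burkholder's method: the special function \<open>burkholder_U\<close> dominates the indicator of
  \<open>\<bar>y\<bar> \<ge> 1\<close> minus \<open>2 * \<bar>x\<bar>\<close>, and it lies below its tangent planes along every increment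
  \<open>(h, k)\<close> with \<open>\<bar>k\<bar> \<le> \<bar>h\<bar>\<close>. After normalisation, the pair (martingale, transform) only makes
  such increments, and the linear terms are bounded predictable multiples of a martingale
  difference. So \<open>burkholder_U\<close> evaluated along the pair has nonincreasing expectation, starting
  from its value 0 at the origin. This yields the constant 2 in place of 16.\<close>

text \<open>Burkholder's function for the weak-type (1,1) inequality. The two formulas agree on the
  boundary of the diamond \<open>|x| + |y| <= 1\<close>, since there
  \<open>y^2 = (1 - |x|)^2\<close>.\<close>

definition burkholder_U :: "real \<Rightarrow> real \<Rightarrow> real" where
  "burkholder_U x y = (if \<bar>x\<bar> + \<bar>y\<bar> \<le> 1 then y^2 - x^2 else 1 - 2 * \<bar>x\<bar>)"

text \<open>The slopes used for the tangent planes. Outside the diamond \<open>sgn\<close> supplies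
  a supergradient of the concave function \<open>- 2 * |x|\<close>; at its kink \<open>x = 0\<close>
  the value \<open>sgn 0 = 0\<close> is one of the admissible choices.\<close>

definition burkholder_Ux :: "real \<Rightarrow> real \<Rightarrow> real" where
  "burkholder_Ux x y = (if \<bar>x\<bar> + \<bar>y\<bar> \<le> 1 then - 2 * x else - 2 * sgn x)"

definition burkholder_Uy :: "real \<Rightarrow> real \<Rightarrow> real" where
  "burkholder_Uy x y = (if \<bar>x\<bar> + \<bar>y\<bar> \<le> 1 then 2 * y else 0)"

lemma burkholder_at_0 [simp]:
  "burkholder_U 0 0 = 0" "burkholder_Ux 0 0 = 0" "burkholder_Uy 0 0 = 0"
  by (simp_all add: burkholder_U_def burkholder_Ux_def burkholder_Uy_def)

lemma abs_burkholder_Ux_le: "\<bar>burkholder_Ux x y\<bar> \<le> 2"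
  by (auto simp: burkholder_Ux_def sgn_if)

lemma abs_burkholder_Uy_le: "\<bar>burkholder_Uy x y\<bar> \<le> 2"
  by (auto simp: burkholder_Uy_def)

text \<open>The bound does not involve \<open>y\<close>, so integrability of the first coordinate
  alone makes the composed function integrable.\<close>

lemma abs_burkholder_U_le: "\<bar>burkholder_U x y\<bar> \<le> 1 + 2 * \<bar>x\<bar>"
proof (cases "\<bar>x\<bar> + \<bar>y\<bar> \<le> 1")
  case True
  then have "\<bar>x\<bar> \<le> 1" "\<bar>y\<bar> \<le> 1" by linarith+
  then have "x^2 \<le> 1" "y^2 \<le> 1" by (simp_all add: abs_square_le_1)
  moreover have "x^2 \<ge> 0" "y^2 \<ge> 0" "\<bar>x\<bar> \<ge> 0" by simp_all
  ultimately have "\<bar>y^2 - x^2\<bar> \<le> 1 + 2 * \<bar>x\<bar>" by linarith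
  then show ?thesis using True by (simp add: burkholder_U_def)
qed (auto simp: burkholder_U_def)

text \<open>Inside the diamond, \<open>|y| >= 1\<close> leaves only the points \<open>(0, 1)\<close>
  and \<open>(0, -1)\<close>, where the function equals 1; elsewhere inside,
  \<open>x^2 <= |x|\<close> suffices. Outside, the indicator is at most 1.\<close>

lemma burkholder_U_majorant: "(if \<bar>y\<bar> \<ge> 1 then 1 else 0) - 2 * \<bar>x\<bar> \<le> burkholder_U x y"
proof (cases "\<bar>x\<bar> + \<bar>y\<bar> \<le> 1")
  case True
  show ?thesis
  proof (cases "\<bar>y\<bar> \<ge> 1")
    case True
    with \<open>\<bar>x\<bar> + \<bar>y\<bar> \<le> 1\<close> have "x = 0" "\<bar>y\<bar> = 1" by linarith+
    then show ?thesis by (auto simp: burkholder_U_def abs_if split: if_splits)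
  next
    case False
    have "\<bar>x\<bar> * \<bar>x\<bar> \<le> 1 * \<bar>x\<bar>"
      using True by (intro mult_right_mono) auto
    then have "x^2 \<le> \<bar>x\<bar>" by (simp add: power2_eq_square)
    moreover have "y^2 \<ge> 0" "\<bar>x\<bar> \<ge> 0" by simp_all
    ultimately have "- 2 * \<bar>x\<bar> \<le> y^2 - x^2" by linarith
    then show ?thesis using True False by (simp add: burkholder_U_def)
  qed
qed (auto simp: burkholder_U_def)

text \<open>Four cases, by whether the start and the end of the increment lie in the diamond. From
  inside, the quadratic differs from its tangent plane by \<open>k^2 - h^2\<close>, which is
  nonpositive. From outside, the plane is \<open>1 - 2 * (sgn x * (x + h))\<close>, which is at
  least \<open>1 - 2 * |x + h|\<close>, and this expression dominates the quadratic inside the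
  diamond.\<close>

lemma burkholder_U_tangent:
  assumes hk: "\<bar>k\<bar> \<le> \<bar>h\<bar>"
  shows "burkholder_U (x + h) (y + k)
           \<le> burkholder_U x y + burkholder_Ux x y * h + burkholder_Uy x y * k"
proof (cases "\<bar>x\<bar> + \<bar>y\<bar> \<le> 1")
  case inside: True
  let ?X = "x + h" and ?Y = "y + k"
  have sq: "k^2 \<le> h^2" using hk by (simp add: abs_le_square_iff)
  have tangent: "burkholder_U x y + burkholder_Ux x y * h + burkholder_Uy x y * k
      = ?Y^2 - ?X^2 + (h^2 - k^2)"
    using inside by (simp add: burkholder_U_def burkholder_Ux_def burkholder_Uy_def
        power2_eq_square algebra_simps)
  show ?thesis
  proof (cases "\<bar>?X\<bar> + \<bar>?Y\<bar> \<le> 1")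
    case True
    then show ?thesis using sq by (simp add: tangent) (simp add: burkholder_U_def)
  next
    case outside: False
    \<comment> \<open>Completing the square: the outer value \<open>1 - 2 * |?X|\<close> equals
      \<open>(1 - |?X|)^2 - ?X^2\<close>.\<close>
    have "(1 - \<bar>?X\<bar>)^2 \<le> ?Y^2 + (h^2 - k^2)"
    proof (cases "\<bar>?X\<bar> \<le> 1")
      case True
      then have "\<bar>1 - \<bar>?X\<bar>\<bar> \<le> \<bar>?Y\<bar>" using outside by linarith
      then have "(1 - \<bar>?X\<bar>)^2 \<le> ?Y^2" by (simp only: abs_le_square_iff)
      with sq show ?thesis by linarith
    next
      case False
      \<comment> \<open>Since \<open>|x| <= 1 - |y|\<close>, one has
        \<open>0 < |?X| - 1 <= |h| - |y|\<close>. The target \<open>?Y^2 + (h^2 - k^2)\<close>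
        expands to \<open>y^2 + 2 * y * k + h^2\<close>, so after squaring only the cross terms
        remain to be compared.\<close>
      have "\<bar>1 - \<bar>?X\<bar>\<bar> \<le> \<bar>\<bar>h\<bar> - \<bar>y\<bar>\<bar>" using False inside by linarith
      then have "(1 - \<bar>?X\<bar>)^2 \<le> (\<bar>h\<bar> - \<bar>y\<bar>)^2" by (simp only: abs_le_square_iff)
      moreover have "- (y * k) \<le> \<bar>y\<bar> * \<bar>h\<bar>"
      proof -
        have "- (y * k) \<le> \<bar>y\<bar> * \<bar>k\<bar>" by (metis abs_ge_minus_self abs_mult)
        also have "\<dots> \<le> \<bar>y\<bar> * \<bar>h\<bar>" using hk by (intro mult_left_mono) auto
        finally show ?thesis .
      qed
      ultimately show ?thesis by (simp add: power2_eq_square algebra_simps)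
    qed
    then have "1 - 2 * \<bar>?X\<bar> \<le> ?Y^2 - ?X^2 + (h^2 - k^2)"
      by (simp add: power2_diff)
    then show ?thesis unfolding tangent using outside by (simp add: burkholder_U_def)
  qed
next
  case outside: False
  let ?X = "x + h" and ?Y = "y + k"
  have tangent: "burkholder_U x y + burkholder_Ux x y * h + burkholder_Uy x y * k
      = 1 - 2 * (sgn x * ?X)"
    using outside by (auto simp: burkholder_U_def burkholder_Ux_def burkholder_Uy_def
        sgn_if algebra_simps)
  have sX: "sgn x * ?X \<le> \<bar>?X\<bar>" by (auto simp: sgn_if)
  show ?thesis
  proof (cases "\<bar>?X\<bar> + \<bar>?Y\<bar> \<le> 1")
    case True
    have "\<bar>?Y\<bar> \<le> \<bar>1 - \<bar>?X\<bar>\<bar>" using True by linarith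
    then have "?Y^2 \<le> (1 - \<bar>?X\<bar>)^2" by (simp only: abs_le_square_iff)
    then have "?Y^2 - ?X^2 \<le> 1 - 2 * \<bar>?X\<bar>" by (simp add: power2_diff)
    then show ?thesis unfolding tangent using True sX by (simp add: burkholder_U_def)
  next
    case False
    then show ?thesis unfolding tangent using sX by (simp add: burkholder_U_def)
  qed
qed

lemma measurable_burkholder [measurable]:
  assumes [measurable]: "u \<in> borel_measurable M" "v \<in> borel_measurable M"
  shows "(\<lambda>x. burkholder_U (u x) (v x)) \<in> borel_measurable M"
    and "(\<lambda>x. burkholder_Ux (u x) (v x)) \<in> borel_measurable M"
    and "(\<lambda>x. burkholder_Uy (u x) (v x)) \<in> borel_measurable M"
  unfolding burkholder_U_def burkholder_Ux_def burkholder_Uy_def sgn_if by measurable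

text \<open>The sign of the conditional expectation is bounded and measurable for \<open>F\<close>,
  so it can be moved onto \<open>f\<close> under the integral, and a sign times \<open>f\<close> is
  at most \<open>|f|\<close>.\<close>

lemma (in sigma_finite_subalgebra) integral_abs_real_cond_exp_le:
  assumes "integrable M f"
  shows "(\<integral>x. \<bar>real_cond_exp M F f x\<bar> \<partial>M) \<le> (\<integral>x. \<bar>f x\<bar> \<partial>M)"
proof -
  have [measurable]: "(\<lambda>x. sgn (real_cond_exp M F f x)) \<in> borel_measurable F"
    unfolding sgn_if by measurable
  have [measurable]: "(\<lambda>x. sgn (real_cond_exp M F f x)) \<in> borel_measurable M"
    by (rule measurable_from_subalg[OF subalg]) measurable
  have [measurable]: "f \<in> borel_measurable M" using assms by auto
  have int: "integrable M (\<lambda>x. sgn (real_cond_exp M F f x) * f x)"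
    by (rule Bochner_Integration.integrable_bound[OF assms]) (auto simp: abs_mult sgn_if)
  have "(\<integral>x. \<bar>real_cond_exp M F f x\<bar> \<partial>M)
      = (\<integral>x. sgn (real_cond_exp M F f x) * real_cond_exp M F f x \<partial>M)"
    by (simp add: abs_sgn mult.commute)
  also have "\<dots> = (\<integral>x. sgn (real_cond_exp M F f x) * f x \<partial>M)"
    by (intro real_cond_exp_intg int) auto
  also have "\<dots> \<le> (\<integral>x. \<bar>f x\<bar> \<partial>M)"
    using int assms by (intro integral_mono) (auto simp: sgn_if)
  finally show ?thesis .
qed

text \<open>Both conditional expectations integrate against \<open>w\<close> to the integral of \<open>w * f\<close>.\<close>

lemma integral_mult_cond_exp_diff:
  assumes "prob_space M" "subalgebra M G" "subalgebra M H" "sets G \<subseteq> sets H"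
    and w: "w \<in> borel_measurable G" "\<And>x. \<bar>w x\<bar> \<le> C"
    and f: "integrable M f"
  shows "integrable M (\<lambda>x. w x * (real_cond_exp M H f x - real_cond_exp M G f x))"
    and "(\<integral>x. w x * (real_cond_exp M H f x - real_cond_exp M G f x) \<partial>M) = 0"
proof -
  interpret prob_space M by fact
  interpret G: finite_measure_subalgebra M G by unfold_locales fact
  interpret H: finite_measure_subalgebra M H by unfold_locales fact
  have "space G = space H" using assms(2,3) by (simp add: subalgebra_def)
  then have "subalgebra H G" using assms(4) by (simp add: subalgebra_def)
  then have wH: "w \<in> borel_measurable H" using w(1) by (rule measurable_from_subalg)
  have [measurable]: "w \<in> borel_measurable M" "f \<in> borel_measurable M"
    using measurable_from_subalg[OF assms(2) w(1)] f by auto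
  have int: "integrable M (\<lambda>x. w x * f x)"
  proof (rule Bochner_Integration.integrable_bound[of M "\<lambda>x. C * f x"])
    show "AE x in M. norm (w x * f x) \<le> norm (C * f x)"
      using w(2) by (auto simp: abs_mult intro!: mult_right_mono order_trans[OF w(2) abs_ge_self])
  qed (use f in auto)
  note G = G.real_cond_exp_intg[OF int w(1)] and H = H.real_cond_exp_intg[OF int wH]
  show "integrable M (\<lambda>x. w x * (real_cond_exp M H f x - real_cond_exp M G f x))"
    using G(1) H(1) by (simp add: right_diff_distrib)
  show "(\<integral>x. w x * (real_cond_exp M H f x - real_cond_exp M G f x) \<partial>M) = 0"
    using G H by (simp add: right_diff_distrib)
qed

theorem theorem4p1:
  fixes M :: "'a measure"
    and F :: "nat \<Rightarrow> 'a measure"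
    and a :: "nat \<Rightarrow> real"
    and f :: "'a \<Rightarrow> real"
    and N :: nat
    and l :: real
  assumes "prob_space M"
    and "complete_measure M"
    and "filtration (space M) (\<lambda>n. F (Suc n))"
    and "\<And>n. n \<ge> 1 \<Longrightarrow> subalgebra M (F n)"
    and "bounded (a ` {1..})"
    and "N \<ge> 1"
    and "integrable M f"
    and "l > 0"
  shows "\<P>(x in M. \<bar>mart_transform M F N a f x\<bar> > l)
           \<le> 16 * linf_norm a * (\<integral>x. \<bar>f x\<bar> \<partial>M) / l"
proof -
  interpret prob_space M by fact
  interpret filtration "space M" "\<lambda>n. F (Suc n)" by fact
  define c where "c = linf_norm a"
  have bdd: "bdd_above ((\<lambda>n. \<bar>a n\<bar>) ` {1..})"
    using assms(5) by (auto simp: bounded_iff bdd_above_def)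
  have a_le: "\<bar>a n\<bar> \<le> c" if "n \<ge> 1" for n
    unfolding c_def linf_norm_def by (rule cSUP_upper[OF _ bdd]) (use that in auto)
  then have c: "c \<ge> 0" using abs_ge_zero[of "a 1"] order_trans by blast
  have subalg: "finite_measure_subalgebra M (F n)" if "n \<ge> 1" for n
    using assms(4)[OF that] by unfold_locales
  have sub_mono: "subalgebra (F n) (F m)" if "1 \<le> m" "m \<le> n" for m n
  proof -
    from that obtain m' n' where "m = Suc m'" "n = Suc n'" "m' \<le> n'"
      by (metis One_nat_def Suc_le_D Suc_le_mono)
    then show ?thesis using space_F[of m'] space_F[of n'] sets_F_mono[of m' n']
      by (simp add: subalgebra_def)
  qed
  \<comment> \<open>Dividing by \<open>l\<close> moves the threshold to 1, and the factor
    \<open>c\<close> makes the increments of \<open>X\<close> dominate those of \<open>Y\<close>.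
    Multiplying by \<open>c\<close> instead of dividing \<open>Y\<close> by it also covers
    \<open>c = 0\<close>.\<close>
  define X where "X n x = c / l * cond_exp_at M F n f x" for n x
  define Y where "Y n x = mart_transform M F n a f x / l" for n x
  have E_meas: "cond_exp_at M F m f \<in> borel_measurable (F n)" if "n \<ge> 1" "m \<le> n" for m n
    using that measurable_from_subalg[OF sub_mono[of m n] borel_measurable_cond_exp]
    by (cases "m = 0") (auto simp: cond_exp_at_def)
  have XY_meas: "X n \<in> borel_measurable (F n)" "Y n \<in> borel_measurable (F n)" if "n \<ge> 1" for n
  proof -
    have [measurable]: "cond_exp_at M F m f \<in> borel_measurable (F n)"
      "cond_exp_at M F (m - Suc 0) f \<in> borel_measurable (F n)" if "m \<in> {1..n}" for m
      using that \<open>n \<ge> 1\<close> by (auto intro!: E_meas)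
    show "X n \<in> borel_measurable (F n)"
      using E_meas[OF that order_refl] unfolding X_def by measurable
    show "Y n \<in> borel_measurable (F n)"
      unfolding Y_def mart_transform_def mart_diff_def by simp measurable
  qed
  have zero: "X 0 x = 0" "Y 0 x = 0" for x
    by (simp_all add: X_def Y_def cond_exp_at_def mart_transform_def)
  \<comment> \<open>Index 0 is separate because nothing is assumed about \<open>F 0\<close>; there
    both functions vanish identically.\<close>
  have [measurable]: "X n \<in> borel_measurable M" "Y n \<in> borel_measurable M" for n
  proof -
    have "X n \<in> borel_measurable M \<and> Y n \<in> borel_measurable M"
    proof (cases "n = 0")
      case True
      then have "X n = (\<lambda>_. 0)" "Y n = (\<lambda>_. 0)" using zero by auto
      then show ?thesis by simp
    next
      case False
      then have "n \<ge> 1" by simp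
      from measurable_from_subalg[OF assms(4)[OF this]] XY_meas[OF this] show ?thesis by blast
    qed
    then show "X n \<in> borel_measurable M" "Y n \<in> borel_measurable M" by auto
  qed
  have E_int: "integrable M (cond_exp_at M F n f)" for n
  proof (cases "n = 0")
    case False
    then interpret finite_measure_subalgebra M "F n" by (intro subalg) simp
    show ?thesis using False real_cond_exp_int(1)[OF assms(7)] by (simp add: cond_exp_at_def)
  qed (simp add: cond_exp_at_def)
  then have X_int: "integrable M (X n)" for n unfolding X_def by simp
  have U_int: "integrable M (\<lambda>x. burkholder_U (X n x) (Y n x))" for n
    by (rule Bochner_Integration.integrable_bound[of M "\<lambda>x. 1 + 2 * \<bar>X n x\<bar>"])
      (use X_int[of n] in \<open>auto intro!: order_trans[OF abs_burkholder_U_le]\<close>)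
  have U_le: "(\<integral>x. burkholder_U (X n x) (Y n x) \<partial>M) \<le> 0" for n
  proof (induction n)
    case 0
    then show ?case by (simp add: zero)
  next
    case (Suc n)
    define d where "d = mart_diff M F f (Suc n)"
    \<comment> \<open>The increments of \<open>X\<close> and \<open>Y\<close> are
      \<open>c / l * d\<close> and \<open>a (Suc n) / l * d\<close>, so both linear terms of the
      tangent plane collapse into one multiple of \<open>d\<close>.\<close>
    define w where "w x = (burkholder_Ux (X n x) (Y n x) * c
        + burkholder_Uy (X n x) (Y n x) * a (Suc n)) / l" for x
    have step: "burkholder_U (X (Suc n) x) (Y (Suc n) x)
        \<le> burkholder_U (X n x) (Y n x) + w x * d x" for x
    proof -
      have "\<bar>a (Suc n) / l * d x\<bar> \<le> \<bar>c / l * d x\<bar>"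
        using a_le[of "Suc n"] c \<open>l > 0\<close>
        by (auto simp: abs_mult intro!: mult_right_mono divide_right_mono)
      from burkholder_U_tangent[OF this, of "X n x" "Y n x"] show ?thesis
        by (simp add: X_def Y_def d_def w_def mart_transform_def mart_diff_def
            algebra_simps add_divide_distrib diff_divide_distrib)
    qed
    have wd: "integrable M (\<lambda>x. w x * d x)" "(\<integral>x. w x * d x \<partial>M) = 0"
    proof -
      have "integrable M (\<lambda>x. w x * d x) \<and> (\<integral>x. w x * d x \<partial>M) = 0"
      \<comment> \<open>The first increment is the conditional expectation at index 1 itself, which
        need not have mean zero. It contributes nothing because both slopes vanish at the origin, so
        \<open>w = 0\<close>.\<close>
      proof (cases "n = 0")
        case True
        then show ?thesis by (simp add: w_def zero)
      next
        case False
        then have n: "n \<ge> 1" by simp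
        note [measurable] = XY_meas[OF n]
        have wm: "w \<in> borel_measurable (F n)" unfolding w_def by measurable
        \<comment> \<open>Each slope is at most 2 in absolute value, and \<open>c\<close> bounds
          both of the factors that multiply the slopes.\<close>
        have wb: "\<bar>w x\<bar> \<le> (2 * c + 2 * c) / l" for x
        proof -
          have "\<bar>burkholder_Ux (X n x) (Y n x) * c\<bar> \<le> 2 * c"
            using c abs_burkholder_Ux_le by (simp add: abs_mult mult_right_mono)
          moreover have "\<bar>burkholder_Uy (X n x) (Y n x) * a (Suc n)\<bar> \<le> 2 * c"
            unfolding abs_mult using a_le[of "Suc n"] by (intro mult_mono abs_burkholder_Uy_le) auto
          ultimately show ?thesis
            unfolding w_def abs_divide using \<open>l > 0\<close>
            by (simp add: divide_right_mono order_trans[OF abs_triangle_ineq])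
        qed
        show ?thesis
          using integral_mult_cond_exp_diff[OF assms(1) assms(4)[of n] assms(4)[of "Suc n"] _ wm wb
              assms(7)] sub_mono[of n "Suc n"] n
          by (auto simp: d_def mart_diff_def cond_exp_at_def subalgebra_def)
      qed
      then show "integrable M (\<lambda>x. w x * d x)" "(\<integral>x. w x * d x \<partial>M) = 0" by auto
    qed
    have "(\<integral>x. burkholder_U (X (Suc n) x) (Y (Suc n) x) \<partial>M)
        \<le> (\<integral>x. burkholder_U (X n x) (Y n x) + w x * d x \<partial>M)"
      using U_int wd step by (intro integral_mono) auto
    also have "\<dots> \<le> 0" using U_int wd Suc by simp
    finally show ?case .
  qed
  interpret FN: finite_measure_subalgebra M "F N" by (rule subalg) fact
  let ?S = "{x \<in> space M. \<bar>mart_transform M F N a f x\<bar> > l}"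
  have S: "?S = {x \<in> space M. \<bar>Y N x\<bar> > 1}" using \<open>l > 0\<close> by (auto simp: Y_def)
  then have [measurable]: "?S \<in> sets M" by simp
  have "prob ?S = (\<integral>x. indicator ?S x \<partial>M)" by simp
  \<comment> \<open>By the majorant property; the \<open>burkholder_U\<close> term then has
    nonpositive integral and drops out, leaving twice the L1 norm of \<open>X N\<close>.\<close>
  also have "\<dots> \<le> (\<integral>x. burkholder_U (X N x) (Y N x) + 2 * \<bar>X N x\<bar> \<partial>M)"
  proof (rule integral_mono)
    show "indicator ?S x \<le> burkholder_U (X N x) (Y N x) + 2 * \<bar>X N x\<bar>" for x
      using burkholder_U_majorant[of "Y N x" "X N x"] unfolding S
      by (auto simp: indicator_def split: if_splits)
  qed (use U_int X_int in \<open>auto simp: less_top[symmetric]\<close>)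
  also have "\<dots> \<le> 2 * (\<integral>x. \<bar>X N x\<bar> \<partial>M)"
    using U_le[of N] U_int X_int by simp
  also have "\<dots> = 2 * (c / l) * (\<integral>x. \<bar>real_cond_exp M (F N) f x\<bar> \<partial>M)"
    using c \<open>l > 0\<close> \<open>N \<ge> 1\<close> by (simp add: X_def abs_mult cond_exp_at_def)
  \<comment> \<open>L1 contraction of the conditional expectation, together with
    \<open>2 <= 16\<close>.\<close>
  also have "\<dots> \<le> 16 * (c / l) * (\<integral>x. \<bar>f x\<bar> \<partial>M)"
    using FN.integral_abs_real_cond_exp_le[OF assms(7)] c \<open>l > 0\<close>
    by (intro mult_mono) (auto intro!: mult_right_mono divide_right_mono)
  finally show ?thesis by (simp add: c_def)
qed

end
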